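(* For every integer $k \ge 2$, the permutation class $\mathcal{I}_k$ is $2$-composable. In particular, $\mathcal{I}_k \subseteq \mathcal{V}_k \circ \mathcal{H}_k$.
   Context: A permutation of order $n$ is a bijection $\pi:[n]\to[n]$, where $[n]=\{1,\dots,n\}$, also viewed as the sequence $\pi(1),\dots,\pi(n)$; the empty permutation (order $0$) is allowed. Two sequences of distinct numbers of the same length are order-isomorphic if their entries are in the same relative order. A permutation $\pi$ is contained in $\sigma$ if $\sigma$ has a (not necessarily contiguous) subsequence order-isomorphic to $\pi$. A permutation class is a set of permutations closed downwards under containment. For permutations $\pi,\sigma$ of the same order, $(\pi\circ\sigma)(i)=\pi(\sigma(i))$. For permutation classes, $\mathcal{A}\circ\mathcal{B}=\{\pi\circ\varphi : \pi\in\mathcal{A},\varphi\in\mathcal{B},|\pi|=|\varphi|\}$; this is an associative operation on permutation classes. A class $\mathcal{C}$ is $k$-composable if there are permutation classes $\mathcal{C}_1,\dots,\mathcal{C}_k\subsetneq\mathcal{C}$ (repetitions allowed) with $\mathcal{C}\subseteq\mathcal{C}_1\circ\cdots\circ\mathcal{C}_k$. $\mathcal{I}_k$ is the class of all permutations whose sequence can be partitioned into at most $k$ increasing subsequences (equivalently, those avoiding $(k+1)k\cdots 21$). $\mathcal{V}_k$ is the class of permutations whose sequence is a concatenation $s_1s_2\cdots s_k$ of $k$ (possibly empty) increasing sequences. $\mathcal{H}_k$ is the class of permutations whose sequence can be partitioned into $k$ (possibly empty) increasing subsequences $s_1,\dots,s_k$ such that every element (value) of $s_i$ is smaller than every element of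 $s_{i+1}$ for $1\le i\le k-1$ (so each $s_i$ uses a set of consecutive integers as values). *)

theory Defs
  imports "HOL-Combinatorics.Multiset_Permutations" "HOL-Library.Sublist"
begin

text \<open>A permutation of order \<open>n\<close> is represented by its sequence \<open>\<pi>(1), \<dots>, \<pi>(n)\<close>, a list of
  naturals. Values range over \<open>{1..n}\<close>, while list positions start at 0, so
  \<open>\<pi>(i) = \<pi> ! (i - 1)\<close>. The empty permutation is included.\<close>

definition perms :: "nat list set" where
  "perms = (\<Union>n. permutations_of_set {1..n})"

definition order_isomorphic :: "nat list \<Rightarrow> nat list \<Rightarrow> bool" where
  "order_isomorphic xs ys \<longleftrightarrow> length xs = length ys \<and>
     (\<forall>i<length xs. \<forall>j<length xs. xs ! i < xs ! j \<longleftrightarrow> ys ! i < ys ! j)"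

definition perm_contained :: "nat list \<Rightarrow> nat list \<Rightarrow> bool" where
  "perm_contained \<pi> \<sigma> \<longleftrightarrow> (\<exists>\<tau>. subseq \<tau> \<sigma> \<and> order_isomorphic \<tau> \<pi>)"

definition perm_class :: "nat list set \<Rightarrow> bool" where
  "perm_class C \<longleftrightarrow> C \<subseteq> perms \<and>
     (\<forall>\<sigma>\<in>C. \<forall>\<pi>\<in>perms. perm_contained \<pi> \<sigma> \<longrightarrow> \<pi> \<in> C)"

definition perm_comp :: "nat list \<Rightarrow> nat list \<Rightarrow> nat list" where
  "perm_comp \<pi> \<sigma> = map (\<lambda>v. \<pi> ! (v - 1)) \<sigma>"

definition class_comp :: "nat list set \<Rightarrow> nat list set \<Rightarrow> nat list set" where
  "class_comp A B = {perm_comp \<pi> \<phi> |\<pi> \<phi>. \<pi> \<in> A \<and> \<phi> \<in> B \<and> length \<pi> = length \<phi>}"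

text \<open>The classes \<open>C\<^sub>1, \<dots>, C\<^sub>k\<close> are given as a nonempty list \<open>D # Ds\<close>; since composition of
  classes is associative, bracketing to the left is no restriction.\<close>

definition composable :: "nat \<Rightarrow> nat list set \<Rightarrow> bool" where
  "composable k C \<longleftrightarrow> perm_class C \<and>
     (\<exists>D Ds. length (D # Ds) = k \<and> (\<forall>E\<in>set (D # Ds). perm_class E \<and> E \<subset> C) \<and>
             C \<subseteq> foldl class_comp D Ds)"

text \<open>A partition of a sequence into \<open>k\<close> possibly empty subsequences is given by a function \<open>c\<close>
  that assigns to each position the number \<open>j < k\<close> of its part, and \<open>part c \<pi> j\<close> is the \<open>j\<close>-th
  part, numbered from 0.\<close>

definition part :: "(nat \<Rightarrow> nat) \<Rightarrow> nat list \<Rightarrow> nat \<Rightarrow> nat list" where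
  "part c \<pi> j = nths \<pi> {i. c i = j}"

definition incr_partition :: "nat \<Rightarrow> (nat \<Rightarrow> nat) \<Rightarrow> nat list \<Rightarrow> bool" where
  "incr_partition k c \<pi> \<longleftrightarrow> (\<forall>i<length \<pi>. c i < k) \<and> (\<forall>j<k. sorted_wrt (<) (part c \<pi> j))"

definition class_I :: "nat \<Rightarrow> nat list set" where
  "class_I k = {\<pi> \<in> perms. \<exists>c. incr_partition k c \<pi>}"

definition class_V :: "nat \<Rightarrow> nat list set" where
  "class_V k = {\<pi> \<in> perms.
     \<exists>ss. length ss = k \<and> (\<forall>s\<in>set ss. sorted_wrt (<) s) \<and> \<pi> = concat ss}"

text \<open>The parts are compared for all \<open>i < j\<close>, not only for \<open>j = i + 1\<close>: parts may be empty, and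
  comparing consecutive parts only would then not force each part to be an interval of
  values.\<close>

definition class_H :: "nat \<Rightarrow> nat list set" where
  "class_H k = {\<pi> \<in> perms. \<exists>c. incr_partition k c \<pi> \<and>
     (\<forall>i j. i < j \<and> j < k \<longrightarrow> (\<forall>a\<in>set (part c \<pi> i). \<forall>b\<in>set (part c \<pi> j). a < b))}"

end

theory Submission
  imports Defs
begin

text \<open>Colour the positions of \<open>\<sigma> \<in> \<I>\<^sub>k\<close> so that each colour class is increasing, and let \<open>\<phi>\<close>
  send a position to its rank when positions are sorted stably by colour. The colouring of \<open>\<sigma>\<close>
  shows that \<open>\<phi> \<in> \<H>\<^sub>k\<close>, while \<open>\<sigma> \<circ> \<phi>\<inverse>\<close> lists the colour classes of \<open>\<sigma>\<close> one after the
  other and so lies in \<open>\<V>\<^sub>k\<close>. The permutation \<open>2 1 4 3 \<dots> 2k (2k - 1)\<close> separates \<open>\<I>\<^sub>k\<close>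
  from both classes: each of its \<open>k\<close> descents forces a new part.\<close>

section \<open>Partitions into increasing parts as colourings of positions\<close>

lemma mem_perms_iff: "\<pi> \<in> perms \<longleftrightarrow> distinct \<pi> \<and> set \<pi> = {1..length \<pi>}"
proof
  assume "\<pi> \<in> perms"
  then obtain n where "set \<pi> = {1..n}" "distinct \<pi>"
    by (auto simp: perms_def permutations_of_set_def)
  moreover from this have "length \<pi> = n"
    using distinct_card by fastforce
  ultimately show "distinct \<pi> \<and> set \<pi> = {1..length \<pi>}" by simp
qed (auto simp: perms_def permutations_of_set_def)

lemma sorted_wrt_filter_upt_iff:
  "sorted_wrt R (filter P [0..<n]) \<longleftrightarrow> (\<forall>i j. i < j \<and> j < n \<and> P i \<and> P j \<longrightarrow> R i j)"
  by (induction n) (auto simp: sorted_wrt_append less_Suc_eq)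

lemma part_conv_filter: "part c \<pi> j = map ((!) \<pi>) (filter (\<lambda>i. c i = j) [0..<length \<pi>])"
proof -
  have "zip \<pi> [0..<length \<pi>] = map (\<lambda>i. (\<pi> ! i, i)) [0..<length \<pi>]"
    by (rule nth_equalityI) auto
  then show ?thesis
    by (simp add: part_def nths_def filter_map comp_def)
qed

lemma set_part: "set (part c \<pi> j) = {\<pi> ! i |i. i < length \<pi> \<and> c i = j}"
  by (auto simp: part_conv_filter)

text \<open>Mentions indices only, so it can be pulled back along maps of positions;
  \<open>incr_partition_iff\<close> ties it to the official notion.\<close>

definition incr_colouring :: "nat \<Rightarrow> (nat \<Rightarrow> nat) \<Rightarrow> nat list \<Rightarrow> bool" where
  "incr_colouring k c \<pi> \<longleftrightarrow> (\<forall>i<length \<pi>. c i < k) \<and>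
     (\<forall>i j. i < j \<and> j < length \<pi> \<and> c i = c j \<longrightarrow> \<pi> ! i < \<pi> ! j)"

text \<open>The extra condition for \<V>: colour classes are blocks of consecutive positions. Its
  counterpart \<open>mono_values\<close> serves \<H>, with blocks of values.\<close>

definition mono_positions :: "(nat \<Rightarrow> nat) \<Rightarrow> nat list \<Rightarrow> bool" where
  "mono_positions c \<pi> \<longleftrightarrow> (\<forall>i j. i < j \<and> j < length \<pi> \<longrightarrow> c i \<le> c j)"

definition mono_values :: "(nat \<Rightarrow> nat) \<Rightarrow> nat list \<Rightarrow> bool" where
  "mono_values c \<pi> \<longleftrightarrow> (\<forall>i<length \<pi>. \<forall>j<length \<pi>. c i < c j \<longrightarrow> \<pi> ! i < \<pi> ! j)"

lemma incr_partition_iff: "incr_partition k c \<pi> \<longleftrightarrow> incr_colouring k c \<pi>"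
  unfolding incr_partition_def incr_colouring_def part_conv_filter sorted_wrt_map
    sorted_wrt_filter_upt_iff
  by fastforce

lemma class_I_iff: "\<pi> \<in> class_I k \<longleftrightarrow> \<pi> \<in> perms \<and> (\<exists>c. incr_colouring k c \<pi>)"
  by (simp add: class_I_def incr_partition_iff)

lemma class_H_iff:
  "\<pi> \<in> class_H k \<longleftrightarrow> \<pi> \<in> perms \<and> (\<exists>c. incr_colouring k c \<pi> \<and> mono_values c \<pi>)"
proof -
  \<comment> \<open>All colours in use are below \<open>k\<close>, so the bound \<open>j < k\<close>
    excludes no pair of positions.\<close>
  have "(\<forall>i j. i < j \<and> j < k \<longrightarrow> (\<forall>a\<in>set (part c \<pi> i). \<forall>b\<in>set (part c \<pi> j). a < b))
      \<longleftrightarrow> mono_values c \<pi>" if "incr_colouring k c \<pi>" for c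
    using that unfolding mono_values_def incr_colouring_def set_part by blast
  then show ?thesis
    unfolding class_H_def incr_partition_iff by blast
qed

text \<open>The top colour occupies a suffix, which the induction on \<open>k\<close> splits off.
  Applied to the list of positions, it reassembles a permutation from its parts.\<close>

lemma concat_filter_colours:
  assumes "sorted_wrt (\<lambda>x y. c x \<le> c y) xs" "\<forall>x\<in>set xs. c x < k"
  shows "concat (map (\<lambda>j. filter (\<lambda>x. c x = j) xs) [0..<k]) = xs"
  using assms
proof (induction k arbitrary: xs)
  case (Suc k)
  have split: "xs = filter (\<lambda>x. c x < k) xs @ filter (\<lambda>x. c x = k) xs"
    using Suc.prems
  proof (induction xs)
    case (Cons x xs)
    show ?case
    proof (cases "c x < k")
      case False
      then have "\<forall>y\<in>set xs. c y = k"
        using Cons.prems by force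
      with False Cons.prems show ?thesis
        by (auto simp: filter_empty_conv intro!: filter_True[symmetric])
    qed (use Cons in auto)
  qed simp
  have "map (\<lambda>j. filter (\<lambda>x. c x = j) xs) [0..<k]
      = map (\<lambda>j. filter (\<lambda>x. c x = j) (filter (\<lambda>x. c x < k) xs)) [0..<k]"
    by (auto intro!: filter_cong)
  moreover have "concat (map (\<lambda>j. filter (\<lambda>x. c x = j) (filter (\<lambda>x. c x < k) xs)) [0..<k])
      = filter (\<lambda>x. c x < k) xs"
    by (rule Suc.IH) (use Suc.prems in \<open>auto intro: sorted_wrt_filter\<close>)
  ultimately have "concat (map (\<lambda>j. filter (\<lambda>x. c x = j) xs) [0..<k])
      = filter (\<lambda>x. c x < k) xs"
    by (simp only:)
  then show ?case
    using split[symmetric] by simp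
qed simp

lemma concat_incr_iff:
  "(\<exists>ss. length ss = k \<and> (\<forall>s\<in>set ss. sorted_wrt (<) s) \<and> \<pi> = concat ss) \<longleftrightarrow>
    (\<exists>c. incr_colouring k c \<pi> \<and> mono_positions c \<pi>)"
proof
  assume "\<exists>ss. length ss = k \<and> (\<forall>s\<in>set ss. sorted_wrt (<) s) \<and> \<pi> = concat ss"
  then obtain ss where "length ss = k" "\<forall>s\<in>set ss. sorted_wrt (<) s" "\<pi> = concat ss"
    by blast
  then show "\<exists>c. incr_colouring k c \<pi> \<and> mono_positions c \<pi>"
  proof (induction ss arbitrary: k \<pi>)
    case (Cons s ss)
    then obtain c where c: "incr_colouring (length ss) c (concat ss)"
      "mono_positions c (concat ss)"
      using Cons.IH[OF refl _ refl] by force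
    let ?c = "\<lambda>i. if i < length s then 0 else Suc (c (i - length s))"
    have "incr_colouring k ?c \<pi>"
      unfolding incr_colouring_def
    proof (intro conjI allI impI)
      fix i assume "i < length \<pi>"
      with c(1) Cons.prems show "?c i < k" by (auto simp: incr_colouring_def)
    next
      fix i j assume "i < j \<and> j < length \<pi> \<and> ?c i = ?c j"
      \<comment> \<open>Subtraction is truncated, so the shift is strictly monotone only past the
        first block.\<close>
      moreover from this have "i - length s < j - length s" if "\<not> i < length s"
        using that by linarith
      ultimately show "\<pi> ! i < \<pi> ! j"
        using c(1) Cons.prems
        by (auto simp: incr_colouring_def nth_append sorted_wrt_iff_nth_less split: if_splits)
    qed
    moreover have "mono_positions ?c \<pi>"
      unfolding mono_positions_def
    proof (intro allI impI)
      fix i j assume "i < j \<and> j < length \<pi>"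
      moreover from this have "i - length s < j - length s" if "\<not> i < length s"
        using that by linarith
      ultimately show "?c i \<le> ?c j"
        using c(2) Cons.prems by (auto simp: mono_positions_def)
    qed
    ultimately show ?case by blast
  qed (auto simp: incr_colouring_def mono_positions_def)
next
  assume "\<exists>c. incr_colouring k c \<pi> \<and> mono_positions c \<pi>"
  then obtain c where c: "incr_colouring k c \<pi>" "mono_positions c \<pi>" by blast
  let ?ss = "map (part c \<pi>) [0..<k]"
  have "concat (map (\<lambda>j. filter (\<lambda>i. c i = j) [0..<length \<pi>]) [0..<k]) = [0..<length \<pi>]"
    using c by (intro concat_filter_colours)
      (auto simp: incr_colouring_def mono_positions_def sorted_wrt_iff_nth_less)
  from arg_cong[OF this, of "map ((!) \<pi>)"] have "concat ?ss = \<pi>"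
    by (simp add: part_conv_filter[abs_def] map_concat comp_def map_nth)
  moreover have "\<forall>s\<in>set ?ss. sorted_wrt (<) s"
    using c(1) by (auto simp: incr_partition_iff[symmetric] incr_partition_def)
  ultimately show "\<exists>ss. length ss = k \<and> (\<forall>s\<in>set ss. sorted_wrt (<) s) \<and> \<pi> = concat ss"
    by (intro exI[of _ ?ss]) simp
qed

lemma class_V_iff:
  "\<pi> \<in> class_V k \<longleftrightarrow> \<pi> \<in> perms \<and> (\<exists>c. incr_colouring k c \<pi> \<and> mono_positions c \<pi>)"
  by (simp add: class_V_def concat_incr_iff)

section \<open>Closure under containment\<close>

lemma subseq_imp_embedding:
  assumes "subseq xs ys"
  obtains f where "\<And>i. i < length xs \<Longrightarrow> f i < length ys \<and> ys ! f i = xs ! i"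
    and "\<And>i j. i < j \<Longrightarrow> j < length xs \<Longrightarrow> f i < f j"
proof -
  from assms have "\<exists>f. (\<forall>i<length xs. f i < length ys \<and> ys ! f i = xs ! i) \<and>
    (\<forall>i j. i < j \<and> j < length xs \<longrightarrow> f i < (f j :: nat))"
  proof (induction rule: list_emb.induct)
    case (list_emb_Cons xs ys y)
    then obtain f where "\<forall>i<length xs. f i < length ys \<and> ys ! f i = xs ! i"
      "\<forall>i j. i < j \<and> j < length xs \<longrightarrow> f i < (f j :: nat)" by blast
    then show ?case by (intro exI[of _ "\<lambda>i. Suc (f i)"]) auto
  next
    case (list_emb_Cons2 x y xs ys)
    then obtain f where "\<forall>i<length xs. f i < length ys \<and> ys ! f i = xs ! i"
      "\<forall>i j. i < j \<and> j < length xs \<longrightarrow> f i < (f j :: nat)" by blast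
    with list_emb_Cons2.hyps show ?case
      \<comment> \<open>The heads are matched with each other; all later positions shift by
        one.\<close>
      by (intro exI[of _ "case_nat 0 (\<lambda>i. Suc (f i))"]) (auto simp: less_Suc_eq_0_disj)
  qed simp
  with that show thesis by blast
qed

text \<open>Since \<open>f\<close> respects the order of positions and of values, a colouring
  \<open>c\<close> of \<sigma> pulls back to the colouring \<open>c \<circ> f\<close> of \<pi>. All
  three closure proofs rest on this.\<close>

lemma perm_containedE:
  assumes "perm_contained \<pi> \<sigma>"
  obtains f where "\<And>i. i < length \<pi> \<Longrightarrow> f i < length \<sigma>"
    and "\<And>i j. i < j \<Longrightarrow> j < length \<pi> \<Longrightarrow> f i < f j"
    and "\<And>i j. i < length \<pi> \<Longrightarrow> j < length \<pi> \<Longrightarrow> \<pi> ! i < \<pi> ! j \<longleftrightarrow> \<sigma> ! f i < \<sigma> ! f j"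
proof -
  from assms obtain \<tau> where \<tau>: "subseq \<tau> \<sigma>" "order_isomorphic \<tau> \<pi>"
    by (auto simp: perm_contained_def)
  from \<tau>(1) obtain f where "\<And>i. i < length \<tau> \<Longrightarrow> f i < length \<sigma> \<and> \<sigma> ! f i = \<tau> ! i"
    and "\<And>i j. i < j \<Longrightarrow> j < length \<tau> \<Longrightarrow> f i < f j"
    by (rule subseq_imp_embedding) blast
  with \<tau>(2) show thesis
    by (intro that[of f]) (auto simp: order_isomorphic_def)
qed

lemma perm_class_I: "perm_class (class_I k)"
  unfolding perm_class_def
proof (intro conjI ballI impI)
  fix \<sigma> \<pi> assume "\<sigma> \<in> class_I k" and \<pi>: "\<pi> \<in> perms" and "perm_contained \<pi> \<sigma>"
  then obtain c where c: "incr_colouring k c \<sigma>" by (auto simp: class_I_iff)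
  from \<open>perm_contained \<pi> \<sigma>\<close> obtain f where "\<And>i. i < length \<pi> \<Longrightarrow> f i < length \<sigma>"
    "\<And>i j. i < j \<Longrightarrow> j < length \<pi> \<Longrightarrow> f i < f j"
    "\<And>i j. i < length \<pi> \<Longrightarrow> j < length \<pi> \<Longrightarrow> \<pi> ! i < \<pi> ! j \<longleftrightarrow> \<sigma> ! f i < \<sigma> ! f j"
    by (rule perm_containedE) blast
  with c have "incr_colouring k (c \<circ> f) \<pi>"
    by (simp add: incr_colouring_def)
  with \<pi> show "\<pi> \<in> class_I k" by (auto simp: class_I_iff)
qed (auto simp: class_I_iff)

lemma perm_class_V: "perm_class (class_V k)"
  unfolding perm_class_def
proof (intro conjI ballI impI)
  fix \<sigma> \<pi> assume "\<sigma> \<in> class_V k" and \<pi>: "\<pi> \<in> perms" and "perm_contained \<pi> \<sigma>"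
  then obtain c where c: "incr_colouring k c \<sigma>" "mono_positions c \<sigma>"
    by (auto simp: class_V_iff)
  from \<open>perm_contained \<pi> \<sigma>\<close> obtain f where "\<And>i. i < length \<pi> \<Longrightarrow> f i < length \<sigma>"
    "\<And>i j. i < j \<Longrightarrow> j < length \<pi> \<Longrightarrow> f i < f j"
    "\<And>i j. i < length \<pi> \<Longrightarrow> j < length \<pi> \<Longrightarrow> \<pi> ! i < \<pi> ! j \<longleftrightarrow> \<sigma> ! f i < \<sigma> ! f j"
    by (rule perm_containedE) blast
  with c have "incr_colouring k (c \<circ> f) \<pi>" "mono_positions (c \<circ> f) \<pi>"
    by (simp_all add: incr_colouring_def mono_positions_def)
  with \<pi> show "\<pi> \<in> class_V k" by (auto simp: class_V_iff)
qed (auto simp: class_V_iff)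

lemma perm_class_H: "perm_class (class_H k)"
  unfolding perm_class_def
proof (intro conjI ballI impI)
  fix \<sigma> \<pi> assume "\<sigma> \<in> class_H k" and \<pi>: "\<pi> \<in> perms" and "perm_contained \<pi> \<sigma>"
  then obtain c where c: "incr_colouring k c \<sigma>" "mono_values c \<sigma>"
    by (auto simp: class_H_iff)
  from \<open>perm_contained \<pi> \<sigma>\<close> obtain f where "\<And>i. i < length \<pi> \<Longrightarrow> f i < length \<sigma>"
    "\<And>i j. i < j \<Longrightarrow> j < length \<pi> \<Longrightarrow> f i < f j"
    "\<And>i j. i < length \<pi> \<Longrightarrow> j < length \<pi> \<Longrightarrow> \<pi> ! i < \<pi> ! j \<longleftrightarrow> \<sigma> ! f i < \<sigma> ! f j"
    by (rule perm_containedE) blast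
  with c have "incr_colouring k (c \<circ> f) \<pi>" "mono_values (c \<circ> f) \<pi>"
    by (simp_all add: incr_colouring_def mono_values_def)
  with \<pi> show "\<pi> \<in> class_H k" by (auto simp: class_H_iff)
qed (auto simp: class_H_iff)

section \<open>A permutation separating \<I> from \<V> and \<H>\<close>

text \<open>Positions start at 0 and values at 1: positions \<open>2 * m\<close> and
  \<open>2 * m + 1\<close> carry \<open>2 * m + 2\<close> and \<open>2 * m + 1\<close>.\<close>

definition swap_pairs :: "nat \<Rightarrow> nat list" where
  "swap_pairs k = map (\<lambda>i. if even i then i + 2 else i) [0..<2 * k]"

lemma length_swap_pairs [simp]: "length (swap_pairs k) = 2 * k"
  by (simp add: swap_pairs_def)

lemma nth_swap_pairs: "i < 2 * k \<Longrightarrow> swap_pairs k ! i = (if even i then i + 2 else i)"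
  by (simp add: swap_pairs_def)

lemma swap_pairs_perms: "swap_pairs k \<in> perms"
proof -
  have "distinct (swap_pairs k)"
    by (auto simp: swap_pairs_def distinct_map inj_on_def split: if_splits)
  moreover have "set (swap_pairs k) \<subseteq> {1..2 * k}"
    by (auto simp: swap_pairs_def elim!: evenE oddE)
  ultimately show ?thesis
    \<comment> \<open>A distinct list of length \<open>2 * k\<close> inside a set of
      \<open>2 * k\<close> values exhausts it.\<close>
    unfolding mem_perms_iff
    by (metis card_atLeastAtMost card_subset_eq diff_Suc_1 distinct_card finite_atLeastAtMost
        length_swap_pairs)
qed

text \<open>Colouring by parity works: entries increase along even and along odd positions.\<close>

lemma swap_pairs_in_class_I:
  assumes "k \<ge> 2"
  shows "swap_pairs k \<in> class_I k"
proof -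
  have "i mod 2 < k" for i :: nat
    using assms mod_less_divisor[of 2 i] by linarith
  then have "incr_colouring k (\<lambda>i. i mod 2) (swap_pairs k)"
    by (auto simp: incr_colouring_def nth_swap_pairs)
  with swap_pairs_perms show ?thesis by (auto simp: class_I_iff)
qed

lemma swap_pairs_colour_neq:
  assumes "incr_colouring k c (swap_pairs l)" "m < l"
  shows "c (2 * m) \<noteq> c (Suc (2 * m))"
proof
  assume "c (2 * m) = c (Suc (2 * m))"
  with assms have "swap_pairs l ! (2 * m) < swap_pairs l ! Suc (2 * m)"
    by (simp add: incr_colouring_def)
  with assms(2) show False by (simp add: nth_swap_pairs)
qed

text \<open>Along positions the colour never drops and rises strictly inside each of the
  \<open>k\<close> pairs, so it would reach \<open>k\<close>.\<close>

lemma swap_pairs_not_in_class_V: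
  assumes "k > 0"
  shows "swap_pairs k \<notin> class_V k"
proof
  assume "swap_pairs k \<in> class_V k"
  then obtain c where c: "incr_colouring k c (swap_pairs k)" "mono_positions c (swap_pairs k)"
    by (auto simp: class_V_iff)
  have mono: "c i \<le> c j" if "i < j" "j < 2 * k" for i j
    using c(2) that by (simp add: mono_positions_def)
  have less: "c (2 * m) < c (Suc (2 * m))" if "m < k" for m
    using mono[of "2 * m" "Suc (2 * m)"] swap_pairs_colour_neq[OF c(1) that] that by linarith
  have "m < c (Suc (2 * m))" if "m < k" for m
    using that
  proof (induction m)
    case 0
    then show ?case using less[of 0] by simp
  next
    case (Suc m)
    then show ?case using less[of "Suc m"] mono[of "Suc (2 * m)" "2 * Suc m"] by simp
  qed
  from this[of "k - 1"] assms have "k \<le> c (Suc (2 * (k - 1)))" by simp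
  moreover have "c (Suc (2 * (k - 1))) < k"
    using c(1) assms by (simp add: incr_colouring_def)
  ultimately show False by simp
qed

text \<open>The same count, run along increasing values: each pair is now traversed from its odd
  position to its even one.\<close>

lemma swap_pairs_not_in_class_H:
  assumes "k > 0"
  shows "swap_pairs k \<notin> class_H k"
proof
  assume "swap_pairs k \<in> class_H k"
  then obtain c where c: "incr_colouring k c (swap_pairs k)" "mono_values c (swap_pairs k)"
    by (auto simp: class_H_iff)
  have mono: "c i \<le> c j" if "i < 2 * k" "j < 2 * k" "swap_pairs k ! i < swap_pairs k ! j" for i j
    using c(2) that unfolding mono_values_def length_swap_pairs by (meson linorder_not_le order.asym)
  have less: "c (Suc (2 * m)) < c (2 * m)" if "m < k" for m
    using mono[of "Suc (2 * m)" "2 * m"] swap_pairs_colour_neq[OF c(1) that] that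
    by (simp add: nth_swap_pairs)
  have "m < c (2 * m)" if "m < k" for m
    using that
  proof (induction m)
    case 0
    then show ?case using less[of 0] by simp
  next
    case (Suc m)
    \<comment> \<open>These positions carry the consecutive values \<open>2 * m + 2\<close> and
      \<open>2 * m + 3\<close>.\<close>
    then have "c (2 * m) \<le> c (Suc (2 * Suc m))"
      by (intro mono) (simp_all add: nth_swap_pairs)
    with Suc show ?case using less[of "Suc m"] by simp
  qed
  from this[of "k - 1"] assms have "k \<le> c (2 * (k - 1))" by simp
  moreover have "c (2 * (k - 1)) < k"
    using c(1) assms by (simp add: incr_colouring_def)
  ultimately show False by simp
qed

section \<open>Factorisation by stable sorting\<close>

lemma class_I_subset_comp: "class_I k \<subseteq> class_comp (class_V k) (class_H k)"
proof
  fix \<sigma> assume "\<sigma> \<in> class_I k"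
  then obtain c where \<sigma>: "\<sigma> \<in> perms" and c: "incr_colouring k c \<sigma>"
    by (auto simp: class_I_iff)
  define n where "n = length \<sigma>"
  \<comment> \<open>For positions below \<open>n\<close> this key encodes the lexicographic order on pairs
    (colour, position).\<close>
  define K where "K i = c i * n + i" for i
  have K_less: "K i < K j \<longleftrightarrow> c i < c j \<or> (c i = c j \<and> i < j)" if "i < n" "j < n" for i j
  proof -
    \<comment> \<open>As \<open>i < n\<close>, the offset \<open>i\<close> cannot carry
      \<open>K i\<close> up to the next multiple of \<open>n\<close>.\<close>
    have *: "K i < K j" if "c i < c j" "i < n" for i j
    proof -
      have "K i < Suc (c i) * n" using that by (simp add: K_def)
      also have "\<dots> \<le> c j * n" using that by (intro mult_le_mono1) simp
      finally show ?thesis by (simp add: K_def)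
    qed
    show ?thesis
      using *[of i j] *[of j i] that by (cases "c i" "c j" rule: linorder_cases) (auto simp: K_def)
  qed
  \<comment> \<open>\<open>s ! p\<close> is the position of \<sigma> that moves to place
    \<open>p\<close>.\<close>
  define s where "s = sort_key K [0..<n]"
  have s: "length s = n" "set s = {..<n}" "distinct s"
    by (auto simp: s_def)
  have s_bij: "bij_betw ((!) s) {..<n} {..<n}"
    using bij_betw_nth[OF s(3)] s by simp
  have s_less: "s ! p < n" if "p < n" for p
    using s_bij that by (auto dest: bij_betwE)
  have K_s: "K (s ! p) < K (s ! q)" if "p < q" "q < n" for p q
  proof -
    \<comment> \<open>Sorting gives only the weak inequality; it is strict because \<open>s\<close>
      is distinct and \<open>K\<close> separates positions below \<open>n\<close>.\<close>
    have "K (s ! p) \<le> K (s ! q)"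
      using sorted_nth_mono[of "map K s" p q] that s(1) by (simp add: s_def)
    moreover have "s ! p \<noteq> s ! q"
      using that s by (simp add: nth_eq_iff_index_eq)
    ultimately show ?thesis
      using that K_less[of "s ! p" "s ! q"] K_less[of "s ! q" "s ! p"] s_less[of p] s_less[of q]
      by linarith
  qed
  \<comment> \<open>The rank of a position in \<open>s\<close>; \<open>r\<close> and
    \<open>(!) s\<close> are mutually inverse on \<open>{..<n}\<close>.\<close>
  define r where "r = inv_into {..<n} ((!) s)"
  have r_bij: "bij_betw r {..<n} {..<n}"
    unfolding r_def by (rule bij_betw_inv_into[OF s_bij])
  have s_r: "s ! r i = i" if "i < n" for i
    using bij_betw_inv_into_right[OF s_bij] that by (simp add: r_def)
  have r_less: "r i < n" if "i < n" for i
    using r_bij that by (auto dest: bij_betwE)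
  have s_lex: "c (s ! p) < c (s ! q) \<or> (c (s ! p) = c (s ! q) \<and> s ! p < s ! q)"
    if "p < q" "q < n" for p q
    using K_s[OF that] K_less[of "s ! p" "s ! q"] s_less[of p] s_less[of q] that by linarith
  have r_mono: "r i < r j" if "c i < c j \<or> (c i = c j \<and> i < j)" "i < n" "j < n" for i j
  proof (rule ccontr)
    assume "\<not> r i < r j"
    moreover have "r i \<noteq> r j"
      using s_r[OF that(2)] s_r[OF that(3)] that(1) by (metis less_irrefl)
    ultimately have "r j < r i" by linarith
    from s_lex[OF this r_less[OF that(2)]] show False
      unfolding s_r[OF that(2)] s_r[OF that(3)] using that(1) by linarith
  qed
  define \<pi> where "\<pi> = map ((!) \<sigma>) s"
  \<comment> \<open>\<open>Suc\<close> turns ranks, which start at 0, into values; the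
    \<open>v - 1\<close> in \<open>perm_comp\<close> undoes it.\<close>
  define \<phi> where "\<phi> = map (\<lambda>i. Suc (r i)) [0..<n]"
  have "set \<pi> = set \<sigma>"
    unfolding \<pi>_def set_map s(2) n_def by (auto simp: set_conv_nth)
  moreover have "distinct \<pi>"
    using \<sigma> s(3) unfolding \<pi>_def distinct_map s(2) n_def
    by (simp add: mem_perms_iff inj_on_nth)
  ultimately have \<pi>_perm: "\<pi> \<in> perms"
    using \<sigma> s(1) by (simp add: mem_perms_iff \<pi>_def n_def)
  have "\<pi> ! p < \<pi> ! q" if "p < q" "q < n" "c (s ! p) = c (s ! q)" for p q
  proof -
    have "s ! p < s ! q" using s_lex[OF that(1,2)] that(3) by linarith
    then have "\<sigma> ! (s ! p) < \<sigma> ! (s ! q)"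
      using c that(3) s_less[OF that(2)] unfolding incr_colouring_def n_def by blast
    then show ?thesis using that by (simp add: \<pi>_def s(1))
  qed
  \<comment> \<open>Each entry of \<pi> keeps the colour that it had in \<sigma>.\<close>
  then have "incr_colouring k (\<lambda>p. c (s ! p)) \<pi>"
    using c s_less by (simp add: incr_colouring_def \<pi>_def s(1) n_def[symmetric])
  moreover have "c (s ! p) \<le> c (s ! q)" if "p < q" "q < n" for p q
    using s_lex[OF that] by linarith
  then have "mono_positions (\<lambda>p. c (s ! p)) \<pi>"
    by (simp add: mono_positions_def \<pi>_def s(1))
  ultimately have V: "\<pi> \<in> class_V k"
    using \<pi>_perm by (auto simp: class_V_iff)
  have "set \<phi> = Suc ` r ` {..<n}"
    by (auto simp: \<phi>_def)
  also have "\<dots> = {1..n}"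
    using bij_betw_imp_surj_on[OF r_bij] by (simp add: image_Suc_lessThan)
  finally have "\<phi> \<in> perms"
    using bij_betw_imp_inj_on[OF r_bij]
    by (simp add: mem_perms_iff \<phi>_def distinct_map inj_on_def)
  \<comment> \<open>\<phi> reuses the colouring of \<sigma>: \<open>r_mono\<close> orders its values
    first by colour, then by position.\<close>
  moreover have "incr_colouring k c \<phi>"
    using c r_mono by (simp add: incr_colouring_def \<phi>_def n_def[symmetric])
  moreover have "mono_values c \<phi>"
    using r_mono by (simp add: mono_values_def \<phi>_def)
  ultimately have H: "\<phi> \<in> class_H k"
    by (auto simp: class_H_iff)
  \<comment> \<open>At position \<open>i\<close> the composition reads
    \<open>\<sigma> ! (s ! r i)\<close>, and \<open>s ! r i = i\<close>.\<close>
  have "perm_comp \<pi> \<phi> = \<sigma>"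
    by (rule nth_equalityI) (auto simp: perm_comp_def \<pi>_def \<phi>_def n_def[symmetric] s(1) r_less s_r)
  moreover have "length \<pi> = length \<phi>"
    by (simp add: \<pi>_def \<phi>_def s(1))
  ultimately show "\<sigma> \<in> class_comp (class_V k) (class_H k)"
    using V H unfolding class_comp_def by blast
qed

theorem theorem4p5:
  fixes k :: nat
  assumes "k \<ge> 2"
  shows "composable 2 (class_I k) \<and> class_I k \<subseteq> class_comp (class_V k) (class_H k)"
proof -
  have "class_V k \<subseteq> class_I k" "class_H k \<subseteq> class_I k"
    by (auto simp: class_V_iff class_H_iff class_I_iff)
  moreover have "swap_pairs k \<in> class_I k" "swap_pairs k \<notin> class_V k"
    "swap_pairs k \<notin> class_H k"
    using assms swap_pairs_in_class_I swap_pairs_not_in_class_V swap_pairs_not_in_class_H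
    by simp_all
  ultimately have "class_V k \<subset> class_I k" "class_H k \<subset> class_I k"
    by blast+
  then have "composable 2 (class_I k)"
    unfolding composable_def using perm_class_I perm_class_V perm_class_H class_I_subset_comp
    \<comment> \<open>With two factors, \<open>foldl\<close> reduces to a single
      \<open>class_comp\<close>.\<close>
    by (intro conjI exI[of _ "class_V k"] exI[of _ "[class_H k]"]) auto
  with class_I_subset_comp show ?thesis by blast
qed

end
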